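(* Fix positive coset-depending weights $w_i:S_{-i}\to(0,\infty)$, $i=1,\dots,n$. Let $\mathcal{G}_P^{cw}\subseteq\mathbb{R}^{nk}$ be the set of all $V_G^T$ where $G$ ranges over the finite games with $n$ players and $|S_i|=k_i$ that are coset weighted potential games with weights $w_i(s_{-i})$. Let $$E_{cw}^P=D_w\begin{bmatrix}\Lambda_1&0&0&\cdots&0\\ \Lambda_2&-\Lambda_2E_1&\Lambda_1E_2&\cdots&0\\ \vdots&\vdots&&\ddots&\vdots\\ \Lambda_n&-\Lambda_nE_1&0&\cdots&\Lambda_1E_n\end{bmatrix},\qquad D_w=\mathrm{diag}(\Lambda_1^{-1},\Lambda_1^{-1},\dots,\Lambda_1^{-1})\ (n\text{ blocks}),$$ and let $E_{cw}^{P^0}$ be the matrix obtained from $E_{cw}^P$ by deleting its last column (the one coming from the last column of the block $\Lambda_1E_n$). Then $$\mathcal{G}_P^{cw}=\mathrm{Span}(E_{cw}^P)\quad(\text{the column span}),$$ and the columns of $E_{cw}^{P^0}$ form a basis of $\mathcal{G}_P^{cw}$.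
   Context: A finite normal form game has players $N=\{1,\dots,n\}$ ($n\ge 2$), strategy sets $S_i=\{1,\dots,k_i\}$ with $k_i\ge2$, profiles $S=\prod_i S_i$, $S_{-i}=\prod_{j\ne i}S_j$, and payoff functions $c_i:S\to\mathbb{R}$. Put $k=\prod_{j=1}^n k_j$. Let $\delta_m^j$ be the $j$-th column of the identity matrix $I_m$; for a profile $s=(s_1,\dots,s_n)$ put $x_j=\delta_{k_j}^{s_j}$. The structure vector of $c_i$ is the row vector $V_i^c\in\mathbb{R}^k$ with $c_i(s)=V_i^c(x_1\otimes\cdots\otimes x_n)$ for all $s\in S$, and $V_G=[V_1^c,\dots,V_n^c]\in\mathbb{R}^{nk}$; a game is identified with $V_G^T\in\mathbb{R}^{nk}$. $G$ is a coset weighted potential game with weights $w_i$ if there is $P:S\to\mathbb{R}$ such that for every $i\in N$, all $x,y\in S_i$ and all $s_{-i}\in S_{-i}$: $c_i(x,s_{-i})-c_i(y,s_{-i})=w_i(s_{-i})\,(P(x,s_{-i})-P(y,s_{-i}))$. The row vector $V_i^w\in\mathbb{R}^{k/k_i}$ is defined by $w_i(s_{-i})=V_i^w\,\bigotimes_{j\ne i}x_j$ (factors in increasing order of $j$). $E_i:=I_{k_1\cdots k_{i-1}}\otimes\mathbf{1}_{k_i}\otimes I_{k_{i+1}\cdots k_n}$, a $k\times (k/k_i)$ matrix, where $\mathbf{1}_m$ is the all-ones column and empty products are $1$. $\Lambda_i$ is the $k\times k$ diagonal matrix whose diagonal entries are the entries of $V_i^wE_i^T\in\mathbb{R}^k$.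 *)

theory Defs
  imports "Jordan_Normal_Form.VS_Connect" "Jordan_Normal_Form.Gauss_Jordan_Elimination"
    "HOL-Library.FuncSet"
begin

section \<open>Kronecker products and block matrices\<close>

definition kron_vec :: "real vec \<Rightarrow> real vec \<Rightarrow> real vec" where
  "kron_vec u v =
     vec (dim_vec u * dim_vec v) (\<lambda>i. u $ (i div dim_vec v) * v $ (i mod dim_vec v))"

definition kron_mat :: "real mat \<Rightarrow> real mat \<Rightarrow> real mat" where
  "kron_mat A B =
     mat (dim_row A * dim_row B) (dim_col A * dim_col B)
       (\<lambda>(i, j). A $$ (i div dim_row B, j div dim_col B) * B $$ (i mod dim_row B, j mod dim_col B))"

text \<open>The product of the vectors x j for j in the finite index set J, in increasing order of j.\<close>

definition kron_family :: "nat set \<Rightarrow> (nat \<Rightarrow> real vec) \<Rightarrow> real vec" where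
  "kron_family J x = foldr kron_vec (map x (sorted_list_of_set J)) (vec 1 (\<lambda>_. 1))"

definition append_cols :: "real mat \<Rightarrow> real mat \<Rightarrow> real mat" where
  "append_cols A B = four_block_mat A B (0\<^sub>m 0 (dim_col A)) (0\<^sub>m 0 (dim_col B))"

text \<open>The matrix with the given rows of blocks.  In both folds the final empty matrix is neutral.\<close>

definition block_mat :: "real mat list list \<Rightarrow> real mat" where
  "block_mat Bss =
     foldr append_rows (map (\<lambda>Bs. foldr append_cols Bs (0\<^sub>m 0 0)) Bss) (0\<^sub>m 0 0)"

definition delete_last_col :: "real mat \<Rightarrow> real mat" where
  "delete_last_col A = mat_of_cols (dim_row A) (butlast (cols A))"


section \<open>Games\<close>

text \<open>
  Players are 1, ..., n and player j has strategies 1, ..., k j.  For a set J of players, the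
  J-profiles are the extensional functions on J, so that J = {1..n} gives S, and
  J = {1..n} - {i} gives the profiles of the opponents of i.  If t is such an opponents' profile,
  the full profile (x, t) is t(i := x).
\<close>

definition profiles :: "(nat \<Rightarrow> nat) \<Rightarrow> nat set \<Rightarrow> (nat \<Rightarrow> nat) set" where
  "profiles k J = (\<Pi>\<^sub>E j\<in>J. {1..k j})"

abbreviation opponents :: "nat \<Rightarrow> nat \<Rightarrow> nat set" where
  "opponents n i \<equiv> {1..n} - {i}"

text \<open>The j-th column of the identity matrix of size m, where j counts from 1.\<close>

definition delta :: "nat \<Rightarrow> nat \<Rightarrow> real vec" where
  "delta m j = col (1\<^sub>m m) (j - 1)"

definition profile_vec :: "(nat \<Rightarrow> nat) \<Rightarrow> nat set \<Rightarrow> (nat \<Rightarrow> nat) \<Rightarrow> real vec" where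
  "profile_vec k J s = kron_family J (\<lambda>j. delta (k j) (s j))"

text \<open>
  Row vectors are represented by vectors, and a row vector times a column vector is a scalar
  product.  For J = {1..n} the following is the structure vector of a payoff function, and for
  J = {1..n} - {i} it is the vector of a weight function.  Existence and uniqueness are shown
  below.
\<close>

definition structure_vec :: "(nat \<Rightarrow> nat) \<Rightarrow> nat set \<Rightarrow> ((nat \<Rightarrow> nat) \<Rightarrow> real) \<Rightarrow> real vec" where
  "structure_vec k J f =
     (THE V. V \<in> carrier_vec (\<Prod>j\<in>J. k j) \<and>
             (\<forall>s\<in>profiles k J. f s = V \<bullet> profile_vec k J s))"

definition game_vec :: "nat \<Rightarrow> (nat \<Rightarrow> nat) \<Rightarrow> (nat \<Rightarrow> (nat \<Rightarrow> nat) \<Rightarrow> real) \<Rightarrow> real vec" where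
  "game_vec n k c = foldr append_vec (map (\<lambda>i. structure_vec k {1..n} (c i)) [1..<Suc n]) (0\<^sub>v 0)"

definition coset_weighted_potential_game ::
  "nat \<Rightarrow> (nat \<Rightarrow> nat) \<Rightarrow> (nat \<Rightarrow> (nat \<Rightarrow> nat) \<Rightarrow> real) \<Rightarrow> (nat \<Rightarrow> (nat \<Rightarrow> nat) \<Rightarrow> real) \<Rightarrow> bool" where
  "coset_weighted_potential_game n k w c \<longleftrightarrow>
     (\<exists>P :: (nat \<Rightarrow> nat) \<Rightarrow> real.
        \<forall>i\<in>{1..n}. \<forall>x\<in>{1..k i}. \<forall>y\<in>{1..k i}. \<forall>t\<in>profiles k (opponents n i).
          c i (t(i := x)) - c i (t(i := y)) = w i t * (P (t(i := x)) - P (t(i := y))))"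

definition cw_potential_games ::
  "nat \<Rightarrow> (nat \<Rightarrow> nat) \<Rightarrow> (nat \<Rightarrow> (nat \<Rightarrow> nat) \<Rightarrow> real) \<Rightarrow> real vec set" where
  "cw_potential_games n k w = {game_vec n k c | c. coset_weighted_potential_game n k w c}"


section \<open>The matrices\<close>

definition E_mat :: "nat \<Rightarrow> (nat \<Rightarrow> nat) \<Rightarrow> nat \<Rightarrow> real mat" where
  "E_mat n k i =
     kron_mat (kron_mat (1\<^sub>m (\<Prod>j\<in>{1..<i}. k j)) (mat (k i) 1 (\<lambda>_. 1))) (1\<^sub>m (\<Prod>j\<in>{i<..n}. k j))"

text \<open>
  The diagonal carries the entries of the row vector V * transpose E, which is the transpose of
  E * transpose V.
\<close>

definition Lambda_mat ::
  "nat \<Rightarrow> (nat \<Rightarrow> nat) \<Rightarrow> (nat \<Rightarrow> (nat \<Rightarrow> nat) \<Rightarrow> real) \<Rightarrow> nat \<Rightarrow> real mat" where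
  "Lambda_mat n k w i =
     mat_diag (\<Prod>j\<in>{1..n}. k j)
       (\<lambda>r. (E_mat n k i *\<^sub>v structure_vec k (opponents n i) (w i)) $ r)"

definition D_mat :: "nat \<Rightarrow> (nat \<Rightarrow> nat) \<Rightarrow> (nat \<Rightarrow> (nat \<Rightarrow> nat) \<Rightarrow> real) \<Rightarrow> real mat" where
  "D_mat n k w = diag_block_mat (replicate n (the (mat_inverse (Lambda_mat n k w 1))))"

definition E_cw :: "nat \<Rightarrow> (nat \<Rightarrow> nat) \<Rightarrow> (nat \<Rightarrow> (nat \<Rightarrow> nat) \<Rightarrow> real) \<Rightarrow> real mat" where
  "E_cw n k w =
     (let K = (\<Prod>j\<in>{1..n}. k j);
          L = Lambda_mat n k w;
          E = E_mat n k
      in D_mat n k w *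
         block_mat
           (map (\<lambda>i. L i
                     # (if i = 1 then 0\<^sub>m K (K div k 1) else - L i * E 1)
                     # map (\<lambda>j. if j = i then L 1 * E j else 0\<^sub>m K (K div k j)) [2..<Suc n])
             [1..<Suc n]))"

definition E_cw0 :: "nat \<Rightarrow> (nat \<Rightarrow> nat) \<Rightarrow> (nat \<Rightarrow> (nat \<Rightarrow> nat) \<Rightarrow> real) \<Rightarrow> real mat" where
  "E_cw0 n k w = delete_last_col (E_cw n k w)"

text \<open>
  The columns of A form a basis of the subspace W of the space of real vectors of dimension m.
  Distinctness is stated separately because the library's notion of basis is about sets.
\<close>

definition cols_basis_of :: "nat \<Rightarrow> real mat \<Rightarrow> real vec set \<Rightarrow> bool" where
  "cols_basis_of m A W \<longleftrightarrow>
     distinct (cols A) \<and>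
     vectorspace.basis class_ring ((module_vec TYPE(real) m)\<lparr>carrier := W\<rparr>) (set (cols A))"


section \<open>Existence and uniqueness of structure vectors\<close>

lemma kron_vec_unit:
  assumes "p < a" "q < b"
  shows "kron_vec (unit_vec a p) (unit_vec b q) = unit_vec (a * b) (p * b + q)"
proof (rule eq_vecI)
  fix i assume "i < dim_vec (unit_vec (a * b) (p * b + q) :: real vec)"
  then have i: "i < a * b" by simp
  have b: "b > 0" using assms by simp
  have "i div b < a" "i mod b < b" using i b by (auto simp: less_mult_imp_div_less)
  moreover have "i = p * b + q \<longleftrightarrow> i div b = p \<and> i mod b = q"
    using assms b by (auto simp: mult.commute)
  ultimately show "kron_vec (unit_vec a p) (unit_vec b q) $ i = unit_vec (a * b) (p * b + q) $ i"
    using i by (auto simp: kron_vec_def unit_vec_def)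
qed (simp add: kron_vec_def)

fun profile_index :: "(nat \<Rightarrow> nat) \<Rightarrow> nat list \<Rightarrow> (nat \<Rightarrow> nat) \<Rightarrow> nat" where
  "profile_index k [] s = 0"
| "profile_index k (j # js) s = (s j - 1) * prod_list (map k js) + profile_index k js s"

lemma profile_index_less:
  "\<forall>j\<in>set js. s j \<in> {1..k j} \<Longrightarrow> profile_index k js s < prod_list (map k js)"
proof (induction js)
  case (Cons j js)
  let ?p = "prod_list (map k js)"
  have "(s j - 1) * ?p + profile_index k js s < (s j - 1) * ?p + ?p" using Cons by auto
  also have "\<dots> = s j * ?p" using Cons.prems by (cases "s j") auto
  also have "\<dots> \<le> k j * ?p" using Cons.prems by auto
  finally show ?case by simp
qed simp

lemma kron_list_unit:
  "\<forall>j\<in>set js. s j \<in> {1..k j} \<Longrightarrow>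
   foldr kron_vec (map (\<lambda>j. delta (k j) (s j)) js) (vec 1 (\<lambda>_. 1))
     = unit_vec (prod_list (map k js)) (profile_index k js s)"
proof (induction js)
  case Nil
  show ?case by (auto intro!: eq_vecI)
next
  case (Cons j js)
  have j: "s j - 1 < k j" using Cons.prems by force
  then have "delta (k j) (s j) = unit_vec (k j) (s j - 1)" by (simp add: delta_def)
  then show ?case
    using Cons kron_vec_unit[OF j profile_index_less[of js s k]] by simp
qed

lemma profile_index_inj:
  assumes "\<forall>j\<in>set js. s j \<in> {1..k j}" "\<forall>j\<in>set js. t j \<in> {1..k j}"
    "profile_index k js s = profile_index k js t"
  shows "\<forall>j\<in>set js. s j = t j"
  using assms
proof (induction js)
  case (Cons j js)
  let ?p = "prod_list (map k js)"
  have less: "profile_index k js s < ?p" "profile_index k js t < ?p"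
    using Cons.prems by (auto intro: profile_index_less)
  have eq: "(s j - 1) * ?p + profile_index k js s = (t j - 1) * ?p + profile_index k js t"
    using Cons.prems by simp
  have p: "?p \<noteq> 0" using less by linarith
  have "s j - 1 = t j - 1"
    using arg_cong[OF eq, of "\<lambda>x. x div ?p"] less p by (simp del: prod_list_zero_iff)
  moreover have "s j \<ge> 1" "t j \<ge> 1" using Cons.prems by auto
  ultimately have "s j = t j" by linarith
  moreover have "profile_index k js s = profile_index k js t"
    using arg_cong[OF eq, of "\<lambda>x. x mod ?p"] less by simp
  then have "\<forall>j\<in>set js. s j = t j"
    using Cons.prems by (intro Cons.IH) simp_all
  ultimately show ?case by simp
qed simp

lemma profile_index_bij:
  assumes "finite J"
  shows "bij_betw (profile_index k (sorted_list_of_set J)) (profiles k J) {..<\<Prod>j\<in>J. k j}"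
    and "s \<in> profiles k J \<Longrightarrow>
      profile_vec k J s = unit_vec (\<Prod>j\<in>J. k j) (profile_index k (sorted_list_of_set J) s)"
proof -
  let ?js = "sorted_list_of_set J"
  have pr: "prod_list (map k ?js) = (\<Prod>j\<in>J. k j)"
    using assms by (simp add: prod.distinct_set_conv_list[symmetric])
  have rng: "\<forall>j\<in>set ?js. s j \<in> {1..k j}" if "s \<in> profiles k J" for s
    using that assms by (auto simp: profiles_def PiE_iff)
  have inj: "inj_on (profile_index k ?js) (profiles k J)"
  proof (rule inj_onI)
    fix s t assume s: "s \<in> profiles k J" and t: "t \<in> profiles k J"
      and eq: "profile_index k ?js s = profile_index k ?js t"
    have "\<forall>j\<in>J. s j = t j"
      using profile_index_inj[OF rng[OF s] rng[OF t] eq] assms by simp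
    with s t show "s = t" unfolding profiles_def by (meson PiE_ext)
  qed
  have sub: "profile_index k ?js ` profiles k J \<subseteq> {..<\<Prod>j\<in>J. k j}"
    using profile_index_less[OF rng] pr by auto
  have "card (profiles k J) = (\<Prod>j\<in>J. k j)"
    using assms by (simp add: profiles_def card_PiE)
  with inj sub have "profile_index k ?js ` profiles k J = {..<\<Prod>j\<in>J. k j}"
    by (intro card_subset_eq) (auto simp: card_image)
  with inj show "bij_betw (profile_index k ?js) (profiles k J) {..<\<Prod>j\<in>J. k j}"
    by (simp add: bij_betw_def)
  show "profile_vec k J s = unit_vec (\<Prod>j\<in>J. k j) (profile_index k ?js s)" if "s \<in> profiles k J"
    using kron_list_unit[OF rng[OF that]] pr by (simp add: profile_vec_def kron_family_def)
qed

lemma structure_vec_ex1: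
  assumes "finite J"
  shows "\<exists>!V. V \<in> carrier_vec (\<Prod>j\<in>J. k j) \<and>
              (\<forall>s\<in>profiles k J. f s = V \<bullet> profile_vec k J s)"
proof -
  let ?m = "\<Prod>j\<in>J. k j" and ?ix = "profile_index k (sorted_list_of_set J)"
  note bij = profile_index_bij(1)[OF assms, of k]
  have lt: "?ix s < ?m" if "s \<in> profiles k J" for s
    using bij that by (auto simp: bij_betw_def)
  have scal: "V \<bullet> profile_vec k J s = V $ ?ix s"
    if "V \<in> carrier_vec ?m" "s \<in> profiles k J" for V s
    using that lt profile_index_bij(2)[OF assms] by simp
  define g where "g = inv_into (profiles k J) ?ix"
  have g: "g r \<in> profiles k J" "?ix (g r) = r" if "r < ?m" for r
    using bij_betw_inv_into_right[OF bij] bij_betwE[OF bij_betw_inv_into[OF bij]] that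
    by (auto simp: g_def)
  show ?thesis
  proof (rule ex1I)
    show "vec ?m (\<lambda>r. f (g r)) \<in> carrier_vec ?m \<and>
          (\<forall>s\<in>profiles k J. f s = vec ?m (\<lambda>r. f (g r)) \<bullet> profile_vec k J s)"
      using bij lt scal by (auto simp: g_def bij_betw_inv_into_left)
  next
    fix V assume V: "V \<in> carrier_vec ?m \<and> (\<forall>s\<in>profiles k J. f s = V \<bullet> profile_vec k J s)"
    show "V = vec ?m (\<lambda>r. f (g r))"
      using V scal g by (intro eq_vecI) auto
  qed
qed

end

theory Submission
  imports Defs "Jordan_Normal_Form.DL_Rank"
begin

text \<open>
  A column vector in the domain of the matrix splits into a function a of all strategies and, for
  every player i, a function g i of the strategies of the opponents of i.  Put P = (a - g 1) / w 1.
  The matrix maps the vector to the game with payoffs w i * P + g i, and every coset weighted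
  potential game has this form.  A vector is in the kernel if and only if a = 0 and P = - g i / w i
  for every i; then P depends on no coordinate at all, so the kernel is the line spanned by a = 0,
  g i = w i.  The last entry of this vector is a value of w n, hence nonzero, and therefore deleting
  the last column removes the kernel and keeps the column space.
\<close>

section \<open>Deleting the last column\<close>

text \<open>The defining condition concerns payoff differences only, so a game amounts to P together
  with the freely chosen functions g i = c i - w i * P of the opponents' strategies. Replacing P by
  P + t and every g i by g i - t * w i, with t constant, leaves the game unchanged; this redundancy
  is the kernel. The matrix uses a = w 1 * P + g 1, the payoff of player 1, as a coordinate in place
  of P. Hence its first row has only one nonzero block, the column block of player 1 enters the
  other rows with a minus sign, and all rows are divided by w 1. Since matrix indices are numbers
  while potentials live on profiles, vectors are read as functions of profiles through the numbering
  \<open>pindex\<close>: \<open>E_mat\<close> then forgets one player, the diagonal matrices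
  multiply by weights, and the rest is algebra of functions.\<close>

lemma delete_last_col_mult_vec:
  assumes A: "A \<in> carrier_mat m (Suc p)" and x: "x \<in> carrier_vec p"
  shows "delete_last_col A *\<^sub>v x = A *\<^sub>v (x @\<^sub>v vec 1 (\<lambda>_. 0))"
    and "delete_last_col A \<in> carrier_mat m p"
proof -
  show C: "delete_last_col A \<in> carrier_mat m p"
    using A by (intro carrier_matI) (simp_all add: delete_last_col_def)
  have ent: "delete_last_col A $$ (r, c) = A $$ (r, c)" if "r < m" "c < p" for r c
    using that A by (simp add: delete_last_col_def mat_of_cols_def nth_butlast)
  show "delete_last_col A *\<^sub>v x = A *\<^sub>v (x @\<^sub>v vec 1 (\<lambda>_. 0))"
    using A C x by (intro eq_vecI) (auto simp: scalar_prod_def ent intro!: sum.cong)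
qed

lemma mat_mult_unit_vec:
  fixes A :: "'a :: semiring_1 mat"
  assumes "i < dim_col A"
  shows "A *\<^sub>v unit_vec (dim_col A) i = col A i"
  using assms by (intro eq_vecI) auto

text \<open>A kernel vector \<open>v\<close> with nonzero last entry writes the last column as a
  combination of the others, so deleting it keeps the column space. By \<open>inj\<close>, no
  nonzero kernel vector has last entry zero, which is independence of the remaining columns.\<close>

lemma cols_basis_of_delete_last_col:
  assumes A: "A \<in> carrier_mat m (Suc p)"
    and inj: "\<And>x. x \<in> carrier_vec (Suc p) \<Longrightarrow> A *\<^sub>v x = 0\<^sub>v m \<Longrightarrow> x $ p = 0 \<Longrightarrow> x = 0\<^sub>v (Suc p)"
    and v: "v \<in> carrier_vec (Suc p)" "A *\<^sub>v v = 0\<^sub>v m" "v $ p \<noteq> 0"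
  shows "cols_basis_of m (delete_last_col A) (vec_space.col_space m A)"
proof -
  interpret vec_space "TYPE(real)" m .
  let ?B = "delete_last_col A"
  have B: "?B \<in> carrier_mat m p"
    using delete_last_col_mult_vec(2)[OF A zero_carrier_vec] .
  note mult = delete_last_col_mult_vec(1)[OF A]
  have inj': "x = 0\<^sub>v p" if x: "x \<in> carrier_vec p" and "?B *\<^sub>v x = 0\<^sub>v m" for x
  proof -
    have *: "x @\<^sub>v vec 1 (\<lambda>_. 0) = 0\<^sub>v (Suc p)"
    proof (rule inj)
      show "x @\<^sub>v vec 1 (\<lambda>_. 0) \<in> carrier_vec (Suc p)"
        by (rule carrier_vecI) (use x in simp)
      show "A *\<^sub>v (x @\<^sub>v vec 1 (\<lambda>_. 0)) = 0\<^sub>v m"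
        using that(2) mult[OF x] by (rule back_subst[of "\<lambda>u. u = _"])
      show "(x @\<^sub>v vec 1 (\<lambda>_. 0)) $ p = 0"
        using x by (subst index_append_vec) auto
    qed
    show ?thesis
    proof (rule eq_vecI)
      fix i assume "i < dim_vec (0\<^sub>v p :: real vec)"
      then show "x $ i = 0\<^sub>v p $ i"
        using arg_cong[OF *, of "\<lambda>u. u $ i"] x by simp
    qed (use x in simp)
  qed
  have dist: "distinct (cols ?B)"
  proof (rule ccontr)
    assume "\<not> distinct (cols ?B)"
    then obtain i j where "i < length (cols ?B)" "j < length (cols ?B)" and ij: "i \<noteq> j"
      and eq: "cols ?B ! i = cols ?B ! j"
      unfolding distinct_conv_nth by blast
    then have lt: "i < p" "j < p" using B by simp_all
    with eq B have eq: "col ?B i = col ?B j" by (simp only: carrier_matD cols_nth)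
    \<comment> \<open>Equal columns would put this difference into the kernel. Distinctness comes
      before independence because \<open>set (cols ?B)\<close> forgets repetitions, and
      \<open>lin_depE\<close> asks for it.\<close>
    let ?u = "unit_vec p i - unit_vec p j :: real vec"
    have "?B *\<^sub>v ?u = ?B *\<^sub>v unit_vec p i - ?B *\<^sub>v unit_vec p j"
      by (rule mult_minus_distrib_mat_vec[OF B]) simp_all
    also have "\<dots> = 0\<^sub>v m"
      using mat_mult_unit_vec[of i ?B] mat_mult_unit_vec[of j ?B] B lt eq by simp
    finally have "?u = 0\<^sub>v p" by (intro inj') simp_all
    then have "?u $ i = 0" using lt by simp
    then have False using lt ij by simp
    then show False .
  qed
  have indpt: "lin_indpt (set (cols ?B))"
  proof
    assume "lin_dep (set (cols ?B))"
    from lin_depE[OF B this dist] inj' show False by metis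
  qed
  have "(\<exists>x\<in>carrier_vec (Suc p). A *\<^sub>v x = y) \<longleftrightarrow> (\<exists>x\<in>carrier_vec p. ?B *\<^sub>v x = y)" for y
  proof
    assume "\<exists>x\<in>carrier_vec p. ?B *\<^sub>v x = y"
    then obtain x where x: "x \<in> carrier_vec p" "?B *\<^sub>v x = y" by blast
    have "x @\<^sub>v vec 1 (\<lambda>_. 0) \<in> carrier_vec (Suc p)"
      by (rule carrier_vecI) (use x in simp)
    then show "\<exists>x\<in>carrier_vec (Suc p). A *\<^sub>v x = y"
      using mult[OF x(1)] x(2) by metis
  next
    assume "\<exists>x\<in>carrier_vec (Suc p). A *\<^sub>v x = y"
    then obtain x where x: "x \<in> carrier_vec (Suc p)" "A *\<^sub>v x = y" by blast
    \<comment> \<open>The multiple of \<open>v\<close> is chosen to cancel the last entry of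
      \<open>x\<close>; as \<open>v\<close> lies in the kernel, the image does not change.\<close>
    define z where "z = x - (x $ p / v $ p) \<cdot>\<^sub>v v"
    have z: "z \<in> carrier_vec (Suc p)" using x v by (simp add: z_def)
    have "A *\<^sub>v z = A *\<^sub>v x - A *\<^sub>v ((x $ p / v $ p) \<cdot>\<^sub>v v)"
      unfolding z_def using x(1) v(1) by (intro mult_minus_distrib_mat_vec[OF A]) simp_all
    also have "\<dots> = y"
      unfolding mult_mat_vec[OF A v(1)] v(2) x(2) using A x(2) by (intro eq_vecI) auto
    finally have Az: "A *\<^sub>v z = y" .
    have "z $ p = 0" using x v by (simp add: z_def)
    then have "vec p (($) z) @\<^sub>v vec 1 (\<lambda>_. 0) = z"
      using z by (intro eq_vecI) (auto simp: less_Suc_eq)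
    then have "?B *\<^sub>v vec p (($) z) = y" using mult[of "vec p (($) z)"] Az by simp
    then show "\<exists>x\<in>carrier_vec p. ?B *\<^sub>v x = y"
      by (intro bexI[of _ "vec p (($) z)"]) auto
  qed
  then have "col_space A = col_space ?B"
    unfolding col_space_eq[OF A] col_space_eq[OF B] using A B by simp
  then have W: "span (set (cols ?B)) = col_space A" by (simp add: col_space_def)
  have sub: "set (cols ?B) \<subseteq> carrier_vec m" using B cols_dim by blast
  have ss: "subspace class_ring (col_space A) V"
    unfolding W[symmetric] by (rule span_is_subspace) (use sub in simp)
  then have sm: "submodule class_ring (col_space A) V" by (simp add: subspace_def)
  have inW: "set (cols ?B) \<subseteq> col_space A"
    unfolding W[symmetric] using in_own_span sub by blast
  interpret W: vectorspace class_ring "vs (col_space A)"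
    by (rule subspace_is_vs[OF ss])
  \<comment> \<open>The basis is meant in the column space as a vector space of its own;
    \<open>span_li_not_depend\<close> carries span and independence over from the ambient
    space.\<close>
  show ?thesis
    unfolding cols_basis_of_def W.basis_def
    using dist indpt inW W span_li_not_depend[OF inW sm] by simp
qed

section \<open>Products of block matrices and vectors\<close>

text \<open>The same fold as in \<open>game_vec\<close>, so that domain vectors and game vectors are
  handled by one set of lemmas.\<close>

definition concat_vec :: "'a :: zero vec list \<Rightarrow> 'a vec" where
  "concat_vec vs = foldr append_vec vs (0\<^sub>v 0)"

lemma concat_vec_Nil [simp]: "concat_vec [] = 0\<^sub>v 0"
  and concat_vec_Cons [simp]: "concat_vec (v # vs) = v @\<^sub>v concat_vec vs"
  by (simp_all add: concat_vec_def)

lemma dim_concat_vec [simp]: "dim_vec (concat_vec vs) = (\<Sum>v\<leftarrow>vs. dim_vec v)"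
  by (induction vs) auto

text \<open>Replaces a vector of the domain by its family of blocks. Distinctness matters because a
  function of the index cannot carry two different blocks at a repeated index.\<close>

lemma concat_vec_split:
  assumes "x \<in> carrier_vec (\<Sum>j\<leftarrow>js. d j)" "distinct js"
  obtains y where "\<And>j. j \<in> set js \<Longrightarrow> y j \<in> carrier_vec (d j)" "x = concat_vec (map y js)"
  using assms
proof (induction js arbitrary: x thesis)
  case Nil
  from Nil.prems(2) have "x = 0\<^sub>v 0" by (intro eq_vecI) simp_all
  then show ?case by (intro Nil.prems(1)[of "\<lambda>_. 0\<^sub>v 0"]) simp_all
next
  case (Cons j js)
  let ?m = "\<Sum>j\<leftarrow>js. d j"
  from Cons.prems(2) have x: "x \<in> carrier_vec (d j + ?m)" by simp
  obtain y where y: "\<And>j. j \<in> set js \<Longrightarrow> y j \<in> carrier_vec (d j)" "vec_last x ?m = concat_vec (map y js)"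
    using Cons.IH[of "vec_last x ?m"] Cons.prems(3) by auto
  have *: "map (y(j := vec_first x (d j))) js = map y js" using Cons.prems(3) by auto
  have "x = concat_vec (map (y(j := vec_first x (d j))) (j # js))"
    using vec_first_last_append[OF x] unfolding list.map concat_vec_Cons * y(2) by simp
  moreover have "(y(j := vec_first x (d j))) i \<in> carrier_vec (d i)" if "i \<in> set (j # js)" for i
    using y(1) that by auto
  ultimately show ?case using Cons.prems(1) by blast
qed

lemma concat_vec_map_eq_iff:
  assumes "\<And>j. j \<in> set js \<Longrightarrow> dim_vec (y j) = dim_vec (z j)"
  shows "concat_vec (map y js) = concat_vec (map z js) \<longleftrightarrow> (\<forall>j\<in>set js. y j = z j)"
  using assms
proof (induction js)
  case (Cons j js)
  have z: "z j \<in> carrier_vec (dim_vec (y j))"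
    by (rule carrier_vecI) (simp add: Cons.prems)
  from append_vec_eq[OF carrier_vec_dim_vec z] Cons show ?case by simp
qed simp

lemma concat_vec_zero: "concat_vec (map (\<lambda>j. 0\<^sub>v (d j)) js) = 0\<^sub>v (\<Sum>j\<leftarrow>js. d j)"
proof (induction js)
  case (Cons j js)
  then show ?case by (intro eq_vecI) auto
qed simp

text \<open>Locates the entry that meets the deleted column inside the final block.\<close>

lemma concat_vec_last:
  assumes "dim_vec u > 0"
  shows "concat_vec (vs @ [u]) $ (dim_vec (concat_vec (vs @ [u])) - 1) = u $ (dim_vec u - 1)"
proof (induction vs)
  case (Cons v vs)
  have "dim_vec v + (\<Sum>w\<leftarrow>vs. dim_vec w) + dim_vec u - 1 - dim_vec v
      = (\<Sum>w\<leftarrow>vs. dim_vec w) + dim_vec u - 1" by simp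
  moreover have "\<not> dim_vec v + (\<Sum>w\<leftarrow>vs. dim_vec w) + dim_vec u - 1 < dim_vec v"
    using assms by linarith
  ultimately show ?case using Cons assms by (simp add: add.assoc)
qed (use assms in simp)

text \<open>The disjunction admits the matrix \<open>0\<^sub>m 0 0\<close> that ends the fold: its
  width is wrong, but it contributes no rows.\<close>

lemma append_rows_mult_vec:
  assumes "dim_col A = dim_vec x" "dim_row B = 0 \<or> dim_col B = dim_vec x"
  shows "append_rows A B *\<^sub>v x = (A *\<^sub>v x) @\<^sub>v (B *\<^sub>v x)"
proof (rule eq_vecI)
  fix i assume "i < dim_vec ((A *\<^sub>v x) @\<^sub>v (B *\<^sub>v x))"
  with assms show "(append_rows A B *\<^sub>v x) $ i = ((A *\<^sub>v x) @\<^sub>v (B *\<^sub>v x)) $ i"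
    by (auto simp: append_rows_def scalar_prod_def)
qed (simp add: append_rows_def)

lemma foldr_append_rows_mult_vec:
  assumes "\<And>j. j \<in> set js \<Longrightarrow> dim_col (A j) = dim_vec x"
  shows "foldr append_rows (map A js) (0\<^sub>m 0 0) *\<^sub>v x = concat_vec (map (\<lambda>j. A j *\<^sub>v x) js)"
  using assms
proof (induction js)
  case Nil
  show ?case by (rule eq_vecI) simp_all
next
  case (Cons j js)
  have "dim_row (foldr append_rows (map A js) (0\<^sub>m 0 0)) = 0 \<or>
      dim_col (foldr append_rows (map A js) (0\<^sub>m 0 0)) = dim_vec x"
    using Cons.prems by (cases js) (auto simp: append_rows_def)
  then show ?case using Cons by (simp add: append_rows_mult_vec)
qed

lemma foldr_append_rows_carrier:
  assumes "\<And>j. j \<in> set js \<Longrightarrow> A j \<in> carrier_mat m c" "js \<noteq> []"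
  shows "foldr append_rows (map A js) (0\<^sub>m 0 0) \<in> carrier_mat (length js * m) c"
proof -
  \<comment> \<open>Sublists \<open>is\<close> are used because \<open>js\<close> is nonempty by
    assumption, whereas the induction has to start at the empty list.\<close>
  have "dim_row (foldr append_rows (map A is) (0\<^sub>m 0 0)) = length is * m"
    if "set is \<subseteq> set js" for "is"
    using that carrier_matD(1)[OF assms(1)] by (induction "is") (simp_all add: append_rows_def)
  moreover have "dim_col (foldr append_rows (map A js) (0\<^sub>m 0 0)) = c"
    using carrier_matD(2)[OF assms(1)] assms(2) by (cases js) (simp_all add: append_rows_def)
  ultimately show ?thesis by (intro carrier_matI) simp_all
qed

lemma diag_block_mat_mult_vec:
  assumes "\<And>j. j \<in> set js \<Longrightarrow> A j \<in> carrier_mat (dim_vec (y j)) (dim_vec (y j))"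
  shows "diag_block_mat (map A js) *\<^sub>v concat_vec (map y js) = concat_vec (map (\<lambda>j. A j *\<^sub>v y j) js)"
  using assms
proof (induction js)
  case Nil
  show ?case by (rule eq_vecI) simp_all
next
  case (Cons j js)
  let ?D = "diag_block_mat (map A js)" and ?c = "concat_vec (map y js)"
  have "dim_row (A i) = dim_vec (y i)" "dim_col (A i) = dim_vec (y i)" if "i \<in> set js" for i
    using carrier_matD[OF Cons.prems[of i]] that by simp_all
  then have "map (dim_row \<circ> A) js = map (dim_vec \<circ> y) js" "map (dim_col \<circ> A) js = map (dim_vec \<circ> y) js"
    by simp_all
  then have D: "?D \<in> carrier_mat (dim_vec ?c) (dim_vec ?c)"
    by (intro carrier_matI) (simp_all add: dim_diag_block_mat del: map_eq_conv)
  have A: "A j \<in> carrier_mat (dim_vec (y j)) (dim_vec (y j))" using Cons.prems by simp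
  have "diag_block_mat (map A (j # js)) =
      four_block_mat (A j) (0\<^sub>m (dim_vec (y j)) (dim_vec ?c)) (0\<^sub>m (dim_vec ?c) (dim_vec (y j))) ?D"
    unfolding diag_block_mat.simps Let_def list.map carrier_matD[OF A] carrier_matD[OF D] ..
  moreover have "y j \<in> carrier_vec (dim_vec (y j))" "?c \<in> carrier_vec (dim_vec ?c)"
    by (rule carrier_vecI, rule refl)+
  moreover have "?D *\<^sub>v ?c = concat_vec (map (\<lambda>j. A j *\<^sub>v y j) js)"
    using Cons by simp
  ultimately show ?case
    using mult_mat_vec_split[OF A D, of "y j" ?c] unfolding list.map concat_vec_Cons by metis
qed

lemma append_cols_simps [simp]:
  "dim_row (append_cols A B) = dim_row A"
  "dim_col (append_cols A B) = dim_col A + dim_col B"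
  "r < dim_row A \<Longrightarrow> c < dim_col A + dim_col B \<Longrightarrow>
    append_cols A B $$ (r, c) = (if c < dim_col A then A $$ (r, c) else B $$ (r, c - dim_col A))"
  by (simp_all add: append_cols_def)

lemma sum_lessThan_add:
  fixes f :: "nat \<Rightarrow> 'a :: comm_monoid_add"
  shows "(\<Sum>c<a + b. f c) = (\<Sum>c<a. f c) + (\<Sum>c<b. f (a + c))"
  by (induction b) (simp_all add: add.assoc)

text \<open>Blocks side by side act on a concatenation by adding up their separate products. The
  claim is made row by row, which avoids a sum of vectors of fixed dimension.\<close>

lemma foldr_append_cols_mult_vec:
  assumes "\<And>j. j \<in> set js \<Longrightarrow> B j \<in> carrier_mat m (dim_vec (y j))" "r < m" "js \<noteq> []"
  defines "M \<equiv> foldr append_cols (map B js) (0\<^sub>m 0 0)"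
  shows "M \<in> carrier_mat m (dim_vec (concat_vec (map y js)))"
    and "(M *\<^sub>v concat_vec (map y js)) $ r = (\<Sum>j\<leftarrow>js. (B j *\<^sub>v y j) $ r)"
proof -
  have B: "dim_row (B j) = m" "dim_col (B j) = dim_vec (y j)" if "j \<in> set js" for j
    using assms(1)[OF that] by (rule carrier_matD)+
  have dim: "dim_col (foldr append_cols (map B is) (0\<^sub>m 0 0)) = (\<Sum>j\<leftarrow>is. dim_vec (y j))"
    if "set is \<subseteq> set js" for "is"
    using that by (induction "is") (simp_all add: B)
  have "dim_row M = m"
    using assms(3) B by (cases js) (simp_all add: M_def)
  then show M: "M \<in> carrier_mat m (dim_vec (concat_vec (map y js)))"
    using dim[of js] by (intro carrier_matI) (simp_all add: M_def o_def)
  \<comment> \<open>The induction runs on the bare sum over columns instead of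
    \<open>*\<^sub>v\<close>: at the empty list the matrix \<open>0\<^sub>m 0 0\<close> has no row
    \<open>r\<close>, while the bare sum is simply 0.\<close>
  have "(\<Sum>c<dim_vec (concat_vec (map y is)).
        foldr append_cols (map B is) (0\<^sub>m 0 0) $$ (r, c) * concat_vec (map y is) $ c) =
      (\<Sum>j\<leftarrow>is. (B j *\<^sub>v y j) $ r)" if "set is \<subseteq> set js" for "is"
    using that
  proof (induction "is")
    case (Cons j "is")
    let ?M = "foldr append_cols (map B is) (0\<^sub>m 0 0)" and ?v = "concat_vec (map y is)"
    have j: "j \<in> set js" and "is": "set is \<subseteq> set js" using Cons.prems by simp_all
    have "(\<Sum>c<dim_vec (concat_vec (map y (j # is))).
        foldr append_cols (map B (j # is)) (0\<^sub>m 0 0) $$ (r, c) * concat_vec (map y (j # is)) $ c) =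
      (\<Sum>c<dim_vec (y j). B j $$ (r, c) * y j $ c) + (\<Sum>c<dim_vec ?v. ?M $$ (r, c) * ?v $ c)"
      using assms(2) B[OF j] dim[OF "is"] by (simp add: sum_lessThan_add o_def)
    moreover have "(B j *\<^sub>v y j) $ r = (\<Sum>c<dim_vec (y j). B j $$ (r, c) * y j $ c)"
      using B[OF j] assms(2) by (simp add: scalar_prod_def lessThan_atLeast0)
    ultimately show ?case
      using Cons.IH[OF "is"] by simp
  qed simp
  from this[OF subset_refl] assms(2) carrier_matD[OF M]
  show "(M *\<^sub>v concat_vec (map y js)) $ r = (\<Sum>j\<leftarrow>js. (B j *\<^sub>v y j) $ r)"
    by (simp add: M_def scalar_prod_def lessThan_atLeast0)
qed

section \<open>Inverses and products of diagonal matrices\<close>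

lemma mat_inverse_eqI:
  fixes A B :: "'a :: field mat"
  assumes A: "A \<in> carrier_mat n n" and B: "B \<in> carrier_mat n n" and AB: "A * B = 1\<^sub>m n" "B * A = 1\<^sub>m n"
  shows "mat_inverse A = Some B"
proof (cases "mat_inverse A")
  case None
  have "A \<in> Units (ring_mat TYPE('a) n ())"
    unfolding Units_def ring_mat_def using A B AB by auto
  with mat_inverse(1)[OF A None, of "()"] show ?thesis by simp
next
  case (Some C)
  then have C: "C * A = 1\<^sub>m n" "C \<in> carrier_mat n n" using mat_inverse(2)[OF A] by auto
  have "C = C * (A * B)" using C AB by simp
  also have "\<dots> = C * A * B" by (rule assoc_mult_mat[symmetric, OF C(2) A B])
  also have "\<dots> = B" using C B by simp
  finally show ?thesis using Some by simp
qed

lemma mat_inverse_mat_diag: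
  fixes f :: "nat \<Rightarrow> 'a :: field"
  assumes "\<And>r. r < n \<Longrightarrow> f r \<noteq> 0"
  shows "mat_inverse (mat_diag n f) = Some (mat_diag n (\<lambda>r. inverse (f r)))"
proof (rule mat_inverse_eqI)
  have "mat_diag n (\<lambda>r. f r * inverse (f r)) = 1\<^sub>m n" "mat_diag n (\<lambda>r. inverse (f r) * f r) = 1\<^sub>m n"
    using assms by (auto simp: mat_diag_def)
  then show "mat_diag n f * mat_diag n (\<lambda>r. inverse (f r)) = 1\<^sub>m n"
    "mat_diag n (\<lambda>r. inverse (f r)) * mat_diag n f = 1\<^sub>m n" by simp_all
qed simp_all

lemma mat_diag_mult_vec:
  fixes f :: "nat \<Rightarrow> 'a :: semiring_0"
  assumes "x \<in> carrier_vec n"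
  shows "mat_diag n f *\<^sub>v x = vec n (\<lambda>r. f r * x $ r)"
proof (rule eq_vecI)
  fix r assume "r < dim_vec (vec n (\<lambda>r. f r * x $ r))"
  then have r: "r < n" by simp
  have "(mat_diag n f *\<^sub>v x) $ r = (\<Sum>c = 0..<n. (if r = c then f c else 0) * x $ c)"
    using r assms by (simp add: mat_diag_def scalar_prod_def)
  also have "\<dots> = (\<Sum>c = 0..<n. if r = c then f c * x $ c else 0)"
    by (rule sum.cong) auto
  finally show "(mat_diag n f *\<^sub>v x) $ r = vec n (\<lambda>r. f r * x $ r) $ r" using r by simp
qed (simp add: mat_diag_def)

section \<open>Indices of profiles\<close>

text \<open>A mixed-radix number with digits \<open>s j - 1\<close>, the largest player in
  \<open>J\<close> being the least significant. Values of \<open>s\<close> outside \<open>J\<close>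
  do not enter, so a full profile may be inserted where an opponents' profile is meant.\<close>

abbreviation pindex :: "(nat \<Rightarrow> nat) \<Rightarrow> nat set \<Rightarrow> (nat \<Rightarrow> nat) \<Rightarrow> nat" where
  "pindex k J \<equiv> profile_index k (sorted_list_of_set J)"

lemma profile_index_cong:
  "(\<And>j. j \<in> set js \<Longrightarrow> s j = t j) \<Longrightarrow> profile_index k js s = profile_index k js t"
  by (induction js) simp_all

lemma profile_index_append:
  "profile_index k (is @ js) s = profile_index k is s * prod_list (map k js) + profile_index k js s"
  by (induction "is") (simp_all add: algebra_simps)

lemma pindex_less:
  assumes "finite J" "s \<in> profiles k J"
  shows "pindex k J s < (\<Prod>j\<in>J. k j)"
  using profile_index_bij(1)[OF assms(1), of k] assms(2) by (auto simp: bij_betw_def)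

lemma pindex_surj:
  assumes "finite J" "r < (\<Prod>j\<in>J. k j)"
  obtains s where "s \<in> profiles k J" "pindex k J s = r"
  using profile_index_bij(1)[OF assms(1), of k] assms(2) unfolding bij_betw_def by (metis imageE lessThan_iff)

lemma restrict_profiles:
  "s \<in> profiles k J \<Longrightarrow> I \<subseteq> J \<Longrightarrow> restrict s I \<in> profiles k I"
  by (auto simp: profiles_def)

lemma pindex_restrict: "finite J \<Longrightarrow> pindex k J (restrict s J) = pindex k J s"
  by (rule profile_index_cong) simp

text \<open>Every index is the number of some profile, so an equation of vectors becomes an equation
  of functions on profiles.\<close>

lemma vec_eq_on_profiles:
  assumes "finite J" "u \<in> carrier_vec (\<Prod>j\<in>J. k j)" "v \<in> carrier_vec (\<Prod>j\<in>J. k j)"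
    and "\<And>s. s \<in> profiles k J \<Longrightarrow> u $ pindex k J s = v $ pindex k J s"
  shows "u = v"
proof (rule eq_vecI)
  fix r assume "r < dim_vec v"
  then have "r < (\<Prod>j\<in>J. k j)" using assms(3) by simp
  then show "u $ r = v $ r" by (rule pindex_surj[OF assms(1)]) (use assms(4) in auto)
qed (use assms in simp)

text \<open>A profile vector is a unit vector, so the scalar product in the definite description
  picks out a single entry.\<close>

lemma structure_vec:
  assumes "finite J"
  shows structure_vec_carrier: "structure_vec k J f \<in> carrier_vec (\<Prod>j\<in>J. k j)"
    and structure_vec_index:
      "s \<in> profiles k J \<Longrightarrow> structure_vec k J f $ pindex k J s = f s"
proof -
  have V: "structure_vec k J f \<in> carrier_vec (\<Prod>j\<in>J. k j) \<and>
      (\<forall>s\<in>profiles k J. f s = structure_vec k J f \<bullet> profile_vec k J s)"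
    unfolding structure_vec_def by (rule theI'[OF structure_vec_ex1[OF assms]])
  then show "structure_vec k J f \<in> carrier_vec (\<Prod>j\<in>J. k j)" ..
  show "structure_vec k J f $ pindex k J s = f s" if "s \<in> profiles k J"
    using V that profile_index_bij(2)[OF assms that] pindex_less[OF assms that] by simp
qed

section \<open>The digit of one player in a profile number, and the matrices
  \<open>E_mat\<close>\<close>

lemma sorted_list_of_players:
  assumes "i \<in> {1..n}"
  shows "sorted_list_of_set {1..n} = [1..<i] @ i # [Suc i..<Suc n]"
    and "sorted_list_of_set (opponents n i) = [1..<i] @ [Suc i..<Suc n]"
proof -
  have "sorted_list_of_set {1..n} = [1..<Suc n]"
    by (metis atLeastLessThanSuc_atLeastAtMost sorted_list_of_set_range)
  also have "\<dots> = [1..<i] @ i # [Suc i..<Suc n]"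
    using assms upt_add_eq_append[of 1 i "Suc n - i"] upt_conv_Cons[of i "Suc n"] by simp
  finally show *: "sorted_list_of_set {1..n} = [1..<i] @ i # [Suc i..<Suc n]" .
  show "sorted_list_of_set (opponents n i) = [1..<i] @ [Suc i..<Suc n]"
    unfolding sorted_list_of_set_remove[OF finite_atLeastAtMost] * by (simp add: remove1_append)
qed

lemma prod_list_upt: "prod_list (map k [a..<b]) = (\<Prod>j\<in>{a..<b}. k j)"
  by (subst prod.distinct_set_conv_list[symmetric]) simp_all

lemma prod_players:
  fixes k :: "nat \<Rightarrow> nat"
  assumes "i \<in> {1..n}"
  shows "(\<Prod>j\<in>{1..n}. k j) = (\<Prod>j\<in>{1..<i}. k j) * k i * (\<Prod>j\<in>{i<..n}. k j)"
    and "(\<Prod>j\<in>opponents n i. k j) = (\<Prod>j\<in>{1..<i}. k j) * (\<Prod>j\<in>{i<..n}. k j)"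
proof -
  have opp: "opponents n i = {1..<i} \<union> {i<..n}" using assms by auto
  show *: "(\<Prod>j\<in>opponents n i. k j) = (\<Prod>j\<in>{1..<i}. k j) * (\<Prod>j\<in>{i<..n}. k j)"
    unfolding opp by (rule prod.union_disjoint) auto
  show "(\<Prod>j\<in>{1..n}. k j) = (\<Prod>j\<in>{1..<i}. k j) * k i * (\<Prod>j\<in>{i<..n}. k j)"
    using prod.remove[OF _ assms, of k] unfolding * by (simp add: mult_ac)
qed

lemma E_mat_carrier:
  assumes "i \<in> {1..n}"
  shows "E_mat n k i \<in> carrier_mat (\<Prod>j\<in>{1..n}. k j) (\<Prod>j\<in>opponents n i. k j)"
  unfolding prod_players[OF assms] by (rule carrier_matI) (simp_all add: E_mat_def kron_mat_def)

text \<open>The row number \<open>r\<close> splits into \<open>r div C div k i\<close>,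
  \<open>r div C mod k i\<close> and \<open>r mod C\<close>, for the players before, at and after
  \<open>i\<close>. The two identity factors demand agreement with the outer digits; the column of
  ones accepts every middle digit.\<close>

lemma E_mat_entry:
  assumes "i \<in> {1..n}" "r < (\<Prod>j\<in>{1..n}. k j)" "c < (\<Prod>j\<in>opponents n i. k j)"
  defines "C \<equiv> (\<Prod>j\<in>{i<..n}. k j)"
  shows "E_mat n k i $$ (r, c) = (if c = r div C div k i * C + r mod C then 1 else 0)"
proof -
  let ?A = "\<Prod>j\<in>{1..<i}. k j"
  have r: "r < ?A * k i * C" and c: "c < ?A * C"
    using assms(2,3) unfolding prod_players[OF assms(1)] C_def by simp_all
  have C: "C > 0" using c by (cases C) simp_all
  have ki: "k i > 0" using r by (cases "k i") simp_all
  have lt: "r div C < ?A * k i" "c div C < ?A" "r div C div k i < ?A" "r mod C < C" "c mod C < C"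
    "r div C mod k i < k i"
    using r c C ki by (simp_all add: less_mult_imp_div_less)
  have "E_mat n k i $$ (r, c) =
      (if r div C div k i = c div C \<and> r mod C = c mod C then 1 else 0)"
    using r c lt by (simp add: E_mat_def kron_mat_def C_def[symmetric])
  also have "r div C div k i = c div C \<and> r mod C = c mod C \<longleftrightarrow> c = r div C div k i * C + r mod C"
    using C by (metis div_mult_mod_eq div_mult_self3 div_less mod_less_divisor mod_mult_self3 mod_mod_trivial add_cancel_right_right less_not_refl3)
  finally show ?thesis by simp
qed

lemma mixed_radix_drop:
  fixes a b m C d :: nat
  assumes "d < C" "b < m"
  shows "((a * m + b) * C + d) div C div m * C + ((a * m + b) * C + d) mod C = a * C + d"
proof -
  have "((a * m + b) * C + d) div C = a * m + b" "(a * m + b) div m = a"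
    using assms by simp_all
  then show ?thesis using assms by simp
qed

text \<open>Dropping the digit of player \<open>i\<close> from the number of \<open>s\<close> yields
  the only column with a one in that row. So \<open>E_mat n k i\<close> turns a function of the
  opponents' profile into the same function read on full profiles.\<close>

lemma E_mat_mult_vec_index:
  assumes i: "i \<in> {1..n}" and s: "s \<in> profiles k {1..n}" and y: "y \<in> carrier_vec (\<Prod>j\<in>opponents n i. k j)"
  shows "(E_mat n k i *\<^sub>v y) $ pindex k {1..n} s = y $ pindex k (opponents n i) s"
proof -
  let ?C = "\<Prod>j\<in>{i<..n}. k j" and ?m = "\<Prod>j\<in>opponents n i. k j"
  let ?a = "profile_index k [1..<i] s" and ?d = "profile_index k [Suc i..<Suc n] s"
  let ?r = "pindex k {1..n} s"
  have rng: "s j \<in> {1..k j}" if "j \<in> {1..n}" for j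
    using s that by (auto simp: profiles_def)
  have C: "prod_list (map k [Suc i..<Suc n]) = ?C"
    unfolding prod_list_upt atLeastLessThanSuc_atLeastAtMost atLeastSucAtMost_greaterThanAtMost ..
  have d: "?d < ?C"
    unfolding C[symmetric] by (rule profile_index_less) (use rng i in auto)
  have si: "s i - 1 < k i" using rng[OF i] by auto
  have r: "?r = (?a * k i + (s i - 1)) * ?C + ?d"
    unfolding sorted_list_of_players(1)[OF i] profile_index_append
    by (simp add: C algebra_simps del: upt_Suc)
  have c: "pindex k (opponents n i) s = ?a * ?C + ?d"
    unfolding sorted_list_of_players(2)[OF i] profile_index_append C ..
  have c': "?r div ?C div k i * ?C + ?r mod ?C = ?a * ?C + ?d"
    unfolding r using mixed_radix_drop[OF d si] .
  have clt: "?a * ?C + ?d < ?m"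
    \<comment> \<open>The full profile \<open>s\<close> is not an opponents' profile, but its
      restriction has the same number.\<close>
    using pindex_less[OF _ restrict_profiles[OF s, of "opponents n i"]]
    unfolding c[symmetric] by (simp only: pindex_restrict finite_Diff finite_atLeastAtMost Diff_subset)
  have rlt: "?r < (\<Prod>j\<in>{1..n}. k j)" using s by (simp add: pindex_less)
  have "(E_mat n k i *\<^sub>v y) $ ?r = (\<Sum>c = 0..<?m. E_mat n k i $$ (?r, c) * y $ c)"
    using E_mat_carrier[OF i, of k] y rlt by (simp add: scalar_prod_def)
  also have "\<dots> = (\<Sum>c = 0..<?m. if c = ?a * ?C + ?d then y $ c else 0)"
  proof (rule sum.cong[OF refl])
    fix c assume "c \<in> {0..<?m}"
    then have "c < ?m" by simp
    from E_mat_entry[OF i rlt this]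
    show "E_mat n k i $$ (?r, c) * y $ c = (if c = ?a * ?C + ?d then y $ c else 0)"
      unfolding c' by simp
  qed
  also have "\<dots> = y $ (?a * ?C + ?d)" using clt by (simp del: upt_Suc)
  finally show ?thesis unfolding c .
qed

lemma fun_upd_profiles:
  assumes "t \<in> profiles k (opponents n i)" "i \<in> {1..n}" "x \<in> {1..k i}"
  shows "t(i := x) \<in> profiles k {1..n}"
    and "restrict (t(i := x)) (opponents n i) = t"
proof -
  show "t(i := x) \<in> profiles k {1..n}"
    using assms unfolding profiles_def by (auto simp: PiE_iff extensional_def)
  have "t \<in> extensional (opponents n i)" using assms(1) by (simp add: profiles_def PiE_iff)
  then show "restrict (t(i := x)) (opponents n i) = t"
    by (intro ext) (auto simp: restrict_def extensional_def)
qed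

section \<open>Game vectors as functions on profiles, and changing one coordinate at a time\<close>

lemma game_vec_eq_concat_vec:
  "game_vec n k c = concat_vec (map (\<lambda>i. structure_vec k {1..n} (c i)) [1..<Suc n])"
  by (simp add: game_vec_def concat_vec_def)

lemma structure_vec_cong:
  assumes "finite J" "\<And>s. s \<in> profiles k J \<Longrightarrow> f s = g s"
  shows "structure_vec k J f = structure_vec k J g"
  by (rule vec_eq_on_profiles[where J = J and k = k])
    (use assms in \<open>simp_all add: structure_vec_carrier structure_vec_index\<close>)

lemma game_vec_cong:
  assumes "\<And>i s. i \<in> {1..n} \<Longrightarrow> s \<in> profiles k {1..n} \<Longrightarrow> c i s = d i s"
  shows "game_vec n k c = game_vec n k d"
proof -
  have "map (\<lambda>i. structure_vec k {1..n} (c i)) [1..<Suc n] = map (\<lambda>i. structure_vec k {1..n} (d i)) [1..<Suc n]"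
    using assms by (intro map_cong refl structure_vec_cong) auto
  then show ?thesis unfolding game_vec_eq_concat_vec by (rule arg_cong)
qed

lemma game_vec_eq_zero_iff:
  "game_vec n k c = 0\<^sub>v (n * (\<Prod>j\<in>{1..n}. k j)) \<longleftrightarrow>
    (\<forall>i\<in>{1..n}. \<forall>s\<in>profiles k {1..n}. c i s = 0)"
proof -
  let ?K = "\<Prod>j\<in>{1..n}. k j"
  have fin: "finite {1..n}" by simp
  have zero: "0\<^sub>v (n * ?K) = concat_vec (map (\<lambda>i. 0\<^sub>v ?K) [1..<Suc n])"
    unfolding concat_vec_zero by (simp add: sum_list_triv del: upt_Suc)
  have "game_vec n k c = 0\<^sub>v (n * ?K) \<longleftrightarrow>
      (\<forall>i\<in>set [1..<Suc n]. structure_vec k {1..n} (c i) = 0\<^sub>v ?K)"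
    unfolding game_vec_eq_concat_vec zero
    by (rule concat_vec_map_eq_iff) (simp only: carrier_vecD[OF structure_vec_carrier[OF fin]] index_zero_vec(2))
  also have "\<dots> \<longleftrightarrow> (\<forall>i\<in>{1..n}. \<forall>s\<in>profiles k {1..n}. c i s = 0)"
  proof -
    have "structure_vec k {1..n} f = 0\<^sub>v ?K \<longleftrightarrow> (\<forall>s\<in>profiles k {1..n}. f s = 0)" for f
    proof
      assume "structure_vec k {1..n} f = 0\<^sub>v ?K"
      then show "\<forall>s\<in>profiles k {1..n}. f s = 0"
        using structure_vec_index[OF fin, of _ k f] pindex_less[OF fin, of _ k] by simp
    next
      assume *: "\<forall>s\<in>profiles k {1..n}. f s = 0"
      show "structure_vec k {1..n} f = 0\<^sub>v ?K"
        by (rule vec_eq_on_profiles[OF fin structure_vec_carrier[OF fin] zero_carrier_vec])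
          (use * structure_vec_index[OF fin, of _ k f] pindex_less[OF fin, of _ k] in simp)
    qed
    moreover have "set [1..<Suc n] = {1..n}" by auto
    ultimately show ?thesis by metis
  qed
  finally show ?thesis .
qed

text \<open>The hybrids \<open>h m\<close> take the strategies of players 1 to \<open>m\<close> from
  \<open>t\<close> and the others from \<open>s\<close>. Consecutive hybrids differ in one
  coordinate only, and all of them are profiles, so \<open>step\<close> applies along the
  way.\<close>

lemma profiles_induct_coordinates:
  assumes s: "s \<in> profiles k {1..n}" and t: "t \<in> profiles k {1..n}"
    and step: "\<And>i s x. i \<in> {1..n} \<Longrightarrow> s \<in> profiles k {1..n} \<Longrightarrow> x \<in> {1..k i} \<Longrightarrow> P (s(i := x)) = P s"
  shows "P s = P t"
proof -
  define h where "h m = (\<lambda>j. if j \<in> {1..m} then t j else s j)" for m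
  have h: "h m \<in> profiles k {1..n}" if "m \<le> n" for m
    using s t that by (auto simp: h_def profiles_def PiE_iff extensional_def)
  have "P (h m) = P s" if "m \<le> n" for m
    using that
  proof (induction m)
    case 0
    have "h 0 = s" by (rule ext) (simp add: h_def)
    then show ?case by simp
  next
    case (Suc m)
    have "h (Suc m) = (h m)(Suc m := t (Suc m))" by (rule ext) (auto simp: h_def)
    moreover have "t (Suc m) \<in> {1..k (Suc m)}"
      using t Suc.prems by (auto simp: profiles_def)
    ultimately have "P (h (Suc m)) = P (h m)"
      using step[of "Suc m" "h m"] h[of m] Suc.prems by simp
    with Suc show ?case by simp
  qed
  moreover have "h n = t"
    using s t by (intro ext) (auto simp: h_def profiles_def PiE_iff extensional_def)
  ultimately show ?thesis by (metis order_refl)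
qed

section \<open>The image and the kernel of the matrix\<close>

context
  fixes n :: nat and k :: "nat \<Rightarrow> nat" and w :: "nat \<Rightarrow> (nat \<Rightarrow> nat) \<Rightarrow> real"
  assumes n: "n \<ge> 2"
    and k: "\<And>i. i \<in> {1..n} \<Longrightarrow> k i \<ge> 2"
    and w: "\<And>i t. i \<in> {1..n} \<Longrightarrow> t \<in> profiles k (opponents n i) \<Longrightarrow> w i t > 0"
begin

abbreviation (input) "K \<equiv> \<Prod>j\<in>{1..n}. k j"

abbreviation (input) "S \<equiv> profiles k {1..n}"

text \<open>Widths of the \<open>n + 1\<close> column blocks: block 0 for a, block j for g
  j.\<close>

definition dims :: "nat \<Rightarrow> nat" where
  "dims j = (if j = 0 then K else K div k j)"

text \<open>The weight read on full profiles; the restriction is needed because \<open>w i\<close>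
  takes extensional profiles of the opponents.\<close>

definition weight :: "nat \<Rightarrow> (nat \<Rightarrow> nat) \<Rightarrow> real" where
  "weight i s = w i (restrict s (opponents n i))"

definition lambda :: "nat \<Rightarrow> nat \<Rightarrow> real" where
  "lambda i r = (E_mat n k i *\<^sub>v structure_vec k (opponents n i) (w i)) $ r"

text \<open>One formula for all column blocks 0 to \<open>n\<close>, so that a block row is a
  \<open>map\<close> over \<open>[0..<Suc n]\<close> and can be summed over its index.\<close>

definition block :: "nat \<Rightarrow> nat \<Rightarrow> real mat" where
  "block i j =
    (if j = 0 then Lambda_mat n k w i
     else if j = 1 then (if i = 1 then 0\<^sub>m K (K div k 1) else - Lambda_mat n k w i * E_mat n k 1)
     else if j = i then Lambda_mat n k w 1 * E_mat n k j else 0\<^sub>m K (K div k j))"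

section \<open>Sizes of the blocks and their action on vectors\<close>

lemma dims_player: "j \<in> {1..n} \<Longrightarrow> dims j = (\<Prod>i\<in>opponents n j. k i)"
  using prod.remove[of "{1..n}" j k] k[of j] by (simp add: dims_def)

lemma weight_pos: "i \<in> {1..n} \<Longrightarrow> s \<in> S \<Longrightarrow> weight i s > 0"
  unfolding weight_def by (intro w restrict_profiles) auto

lemma lambda_pindex: "i \<in> {1..n} \<Longrightarrow> s \<in> S \<Longrightarrow> lambda i (pindex k {1..n} s) = weight i s"
  using E_mat_mult_vec_index[of i n s k "structure_vec k (opponents n i) (w i)"]
    structure_vec_index[of "opponents n i" "restrict s (opponents n i)" k "w i"]
    restrict_profiles[of s k "{1..n}" "opponents n i"]
  by (simp add: lambda_def weight_def structure_vec_carrier pindex_restrict)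

lemma lambda_pos: "i \<in> {1..n} \<Longrightarrow> r < K \<Longrightarrow> lambda i r > 0"
  by (metis pindex_surj finite_atLeastAtMost lambda_pindex weight_pos)

lemma Lambda_mat_eq: "Lambda_mat n k w i = mat_diag K (lambda i)"
  by (simp add: Lambda_mat_def lambda_def[abs_def])

text \<open>Positive weights give nonzero diagonal entries, so \<open>the\<close> in
  \<open>D_mat\<close> really meets a \<open>Some\<close>.\<close>

lemma D_mat_eq:
  "D_mat n k w = diag_block_mat (map (\<lambda>_. mat_diag K (\<lambda>r. inverse (lambda 1 r))) [1..<Suc n])"
proof -
  have "mat_inverse (Lambda_mat n k w 1) = Some (mat_diag K (\<lambda>r. inverse (lambda 1 r)))"
    unfolding Lambda_mat_eq
  proof (rule mat_inverse_mat_diag)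
    show "lambda 1 r \<noteq> 0" if "r < K" for r
      using lambda_pos[of 1 r] n that by simp
  qed
  then show ?thesis unfolding D_mat_def map_replicate_const by (simp del: upt_Suc)
qed

lemma E_cw_eq:
  "E_cw n k w = D_mat n k w *
     foldr append_rows (map (\<lambda>i. foldr append_cols (map (block i) [0..<Suc n]) (0\<^sub>m 0 0)) [1..<Suc n]) (0\<^sub>m 0 0)"
proof -
  have upt: "[0..<Suc n] = 0 # 1 # [2..<Suc n]"
    using n by (simp add: upt_conv_Cons numeral_2_eq_2 del: upt_Suc)
  have blocks: "map (block i) [2..<Suc n] =
      map (\<lambda>j. if j = i then Lambda_mat n k w 1 * E_mat n k j else 0\<^sub>m K (K div k j)) [2..<Suc n]" for i
    by (intro map_cong refl) (auto simp: block_def)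
  show ?thesis
    unfolding E_cw_def block_mat_def Let_def map_map o_def upt list.map
    by (simp add: blocks block_def del: upt_Suc)
qed

lemma E_mat_carrier': "i \<in> {1..n} \<Longrightarrow> E_mat n k i \<in> carrier_mat K (dims i)"
  using E_mat_carrier dims_player by simp

lemma block_carrier:
  assumes "i \<in> {1..n}" "j \<in> {0..n}"
  shows "block i j \<in> carrier_mat K (dims j)"
proof -
  have L: "Lambda_mat n k w i \<in> carrier_mat K K" for i by (simp add: Lambda_mat_eq)
  have "K div k 1 = dims 1" by (simp add: dims_def)
  then show ?thesis
    using L mult_carrier_mat[OF L E_mat_carrier'[of j], of 1]
      mult_carrier_mat[OF uminus_carrier_mat[OF L] E_mat_carrier'[of 1], of i] assms n
    unfolding block_def by (auto simp: dims_def)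
qed

lemma K_pos: "K > 0"
  using k by (intro prod_pos) force

lemma block_row_carrier:
  assumes "i \<in> {1..n}"
  shows "foldr append_cols (map (block i) [0..<Suc n]) (0\<^sub>m 0 0)
    \<in> carrier_mat K (\<Sum>j\<leftarrow>[0..<Suc n]. dims j)"
proof -
  \<comment> \<open>The zero vectors only supply the block widths, which
    \<open>foldr_append_cols_mult_vec\<close> reads off a family of vectors; \<open>K_pos\<close>
    supplies the row it asks for.\<close>
  have "block i j \<in> carrier_mat K (dim_vec (0\<^sub>v (dims j) :: real vec))" if "j \<in> set [0..<Suc n]" for j
    using block_carrier[OF assms, of j] that by auto
  moreover have "[0..<Suc n] \<noteq> []" by simp
  ultimately have "foldr append_cols (map (block i) [0..<Suc n]) (0\<^sub>m 0 0)
    \<in> carrier_mat K (dim_vec (concat_vec (map (\<lambda>j. 0\<^sub>v (dims j) :: real vec) [0..<Suc n])))"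
    by (intro foldr_append_cols_mult_vec(1)[OF _ K_pos])
  then show ?thesis unfolding concat_vec_zero index_zero_vec(2) .
qed

lemma D_mat_carrier: "D_mat n k w \<in> carrier_mat (n * K) (n * K)"
  unfolding D_mat_eq
  by (rule carrier_matI) (simp_all add: dim_diag_block_mat o_def mat_diag_def sum_list_triv del: upt_Suc)

lemma block_mat_carrier:
  "foldr append_rows (map (\<lambda>i. foldr append_cols (map (block i) [0..<Suc n]) (0\<^sub>m 0 0)) [1..<Suc n]) (0\<^sub>m 0 0)
    \<in> carrier_mat (n * K) (\<Sum>j\<leftarrow>[0..<Suc n]. dims j)"
proof -
  have "[1..<Suc n] \<noteq> []" using n by simp
  from foldr_append_rows_carrier[OF block_row_carrier this]
  show ?thesis by (simp del: upt_Suc)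
qed

lemma E_cw_carrier: "E_cw n k w \<in> carrier_mat (n * K) (\<Sum>j\<leftarrow>[0..<Suc n]. dims j)"
  unfolding E_cw_eq by (rule mult_carrier_mat[OF D_mat_carrier block_mat_carrier])

lemma block_mult_vec:
  assumes i: "i \<in> {1..n}" and j: "j \<in> {0..n}" and r: "r < K" and y: "y \<in> carrier_vec (dims j)"
  shows "(block i j *\<^sub>v y) $ r =
    (if j = 0 then lambda i r * y $ r
     else if j = 1 then (if i = 1 then 0 else - (lambda i r * (E_mat n k 1 *\<^sub>v y) $ r))
     else if j = i then lambda 1 r * (E_mat n k j *\<^sub>v y) $ r else 0)"
proof -
  have L: "Lambda_mat n k w i \<in> carrier_mat K K" for i by (simp add: Lambda_mat_eq)
  have Lx: "(Lambda_mat n k w i *\<^sub>v x) $ r = lambda i r * x $ r" if "x \<in> carrier_vec K" for i x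
    using r that by (simp add: Lambda_mat_eq mat_diag_mult_vec)
  have LE: "(Lambda_mat n k w i * E_mat n k j *\<^sub>v y) $ r = lambda i r * (E_mat n k j *\<^sub>v y) $ r"
    if "j \<noteq> 0" for i
  proof -
    have E: "E_mat n k j \<in> carrier_mat K (dims j)" using E_mat_carrier' j that by simp
    show ?thesis
      unfolding assoc_mult_mat_vec[OF L E y] by (rule Lx) (rule mult_mat_vec_carrier[OF E y])
  qed
  have neg: "(- Lambda_mat n k w i * E_mat n k j *\<^sub>v y) $ r = - (lambda i r * (E_mat n k j *\<^sub>v y) $ r)"
    if "j \<noteq> 0" for i
  proof -
    have E: "E_mat n k j \<in> carrier_mat K (dims j)" using E_mat_carrier' j that by simp
    have d: "dim_vec (E_mat n k j *\<^sub>v y) = K" using E by simp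
    have "(- Lambda_mat n k w i * E_mat n k j *\<^sub>v y) $ r = (- (Lambda_mat n k w i *\<^sub>v (E_mat n k j *\<^sub>v y))) $ r"
      unfolding assoc_mult_mat_vec[OF uminus_carrier_mat[OF L] E y]
      by (subst uminus_mult_mat_vec) (simp_all only: d carrier_matD[OF L])
    also have "\<dots> = - ((Lambda_mat n k w i *\<^sub>v (E_mat n k j *\<^sub>v y)) $ r)"
      using L[of i] r by simp
    also have "\<dots> = - (lambda i r * (E_mat n k j *\<^sub>v y) $ r)"
      using Lx[OF mult_mat_vec_carrier[OF E y]] by simp
    finally show ?thesis .
  qed
  have zero: "(0\<^sub>m K (dims j) *\<^sub>v y) $ r = 0"
    using y r by (simp add: scalar_prod_def)
  consider "j = 0" | "j = 1" | "j \<noteq> 0" "j \<noteq> 1" by blast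
  then show ?thesis
  proof cases
    case 1
    then show ?thesis using Lx[of y i] y by (simp add: block_def dims_def)
  next
    case 2
    then show ?thesis using neg[of i] zero by (simp add: block_def dims_def)
  next
    case 3
    then show ?thesis using LE[of 1] zero by (auto simp: block_def dims_def)
  qed
qed

text \<open>Below, y 0 is the function a and y i the function g i of the introduction.\<close>

definition potential :: "(nat \<Rightarrow> real vec) \<Rightarrow> (nat \<Rightarrow> nat) \<Rightarrow> real" where
  "potential y s = (y 0 $ pindex k {1..n} s - y 1 $ pindex k (opponents n 1) s) / weight 1 s"

definition payoff :: "(nat \<Rightarrow> real vec) \<Rightarrow> nat \<Rightarrow> (nat \<Rightarrow> nat) \<Rightarrow> real" where
  "payoff y i s = weight i s * potential y s + y i $ pindex k (opponents n i) s"

text \<open>For i > 1, row i gives w i * a - w i * g 1 + w 1 * g i before scaling, and division by w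
  1 leaves w i * P + g i. Row 1 gives w 1 * a, hence a after scaling, and this is w 1 * P + g 1 by
  the choice of P.\<close>

lemma E_cw_mult_vec:
  assumes y: "\<And>j. j \<in> {0..n} \<Longrightarrow> y j \<in> carrier_vec (dims j)"
  shows "E_cw n k w *\<^sub>v concat_vec (map y [0..<Suc n]) = game_vec n k (payoff y)"
proof -
  define x where "x = concat_vec (map y [0..<Suc n])"
  define R where "R i = foldr append_cols (map (block i) [0..<Suc n]) (0\<^sub>m 0 0)" for i
  define D where "D = mat_diag K (\<lambda>r. inverse (lambda 1 r))"
  have yd: "dim_vec (y j) = dims j" if "j \<in> set [0..<Suc n]" for j
    using y[of j] that by auto
  have x: "x \<in> carrier_vec (\<Sum>j\<leftarrow>[0..<Suc n]. dims j)"
    by (rule carrier_vecI) (simp only: x_def dim_concat_vec map_map o_def yd cong: map_cong)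
  have R: "R i \<in> carrier_mat K (\<Sum>j\<leftarrow>[0..<Suc n]. dims j)" if "i \<in> set [1..<Suc n]" for i
    unfolding R_def using that by (intro block_row_carrier) auto
  have z: "R i *\<^sub>v x \<in> carrier_vec K" if "i \<in> set [1..<Suc n]" for i
    using R[OF that] x by (rule mult_mat_vec_carrier)
  have D: "D \<in> carrier_mat (dim_vec (R i *\<^sub>v x)) (dim_vec (R i *\<^sub>v x))" if "i \<in> set [1..<Suc n]" for i
    unfolding carrier_vecD[OF z[OF that]] D_def by simp
  have "E_cw n k w *\<^sub>v x = D_mat n k w *\<^sub>v (foldr append_rows (map R [1..<Suc n]) (0\<^sub>m 0 0) *\<^sub>v x)"
    unfolding E_cw_eq R_def[abs_def] by (rule assoc_mult_mat_vec[OF D_mat_carrier block_mat_carrier x])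
  also have "foldr append_rows (map R [1..<Suc n]) (0\<^sub>m 0 0) *\<^sub>v x = concat_vec (map (\<lambda>i. R i *\<^sub>v x) [1..<Suc n])"
    by (rule foldr_append_rows_mult_vec) (simp only: carrier_matD[OF R] carrier_vecD[OF x])
  also have "D_mat n k w *\<^sub>v \<dots> = concat_vec (map (\<lambda>i. D *\<^sub>v (R i *\<^sub>v x)) [1..<Suc n])"
    unfolding D_mat_eq D_def[symmetric] by (rule diag_block_mat_mult_vec[OF D])
  also have "map (\<lambda>i. D *\<^sub>v (R i *\<^sub>v x)) [1..<Suc n] = map (\<lambda>i. structure_vec k {1..n} (payoff y i)) [1..<Suc n]"
  proof (intro map_cong refl)
    fix i assume i': "i \<in> set [1..<Suc n]"
    then have i: "i \<in> {1..n}" by auto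
    show "D *\<^sub>v (R i *\<^sub>v x) = structure_vec k {1..n} (payoff y i)"
    proof (rule vec_eq_on_profiles[OF finite_atLeastAtMost _ structure_vec_carrier[OF finite_atLeastAtMost]])
      show "D *\<^sub>v (R i *\<^sub>v x) \<in> carrier_vec K"
        unfolding D_def by (rule mult_mat_vec_carrier[OF mat_diag_dim z[OF i']])
      fix s assume s: "s \<in> S"
      let ?r = "pindex k {1..n} s"
      define f where "f j = (block i j *\<^sub>v y j) $ ?r" for j
      have r: "?r < K" using s by (simp only: pindex_less finite_atLeastAtMost)
      have one: "1 \<in> {1..n}" using n by simp
      have E: "(E_mat n k j *\<^sub>v y j) $ ?r = y j $ pindex k (opponents n j) s" if "j \<in> {1..n}" for j
        using y[of j] that unfolding dims_player[OF that] by (intro E_mat_mult_vec_index[OF that s]) simp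
      have f: "f j = (if j = 0 then weight i s * y 0 $ ?r
          else if j = 1 then (if i = 1 then 0 else - (weight i s * y 1 $ pindex k (opponents n 1) s))
          else if j = i then weight 1 s * y i $ pindex k (opponents n i) s else 0)" if "j \<in> {0..n}" for j
        unfolding f_def block_mult_vec[OF i that r y[OF that]] lambda_pindex[OF i s] lambda_pindex[OF one s]
        using E[OF i] E[OF one] by auto
      have "block i j \<in> carrier_mat K (dim_vec (y j))" if "j \<in> set [0..<Suc n]" for j
        unfolding yd[OF that] using that i by (intro block_carrier) auto
      moreover have "[0..<Suc n] \<noteq> []" by simp
      ultimately have "(R i *\<^sub>v x) $ ?r = (\<Sum>j\<leftarrow>[0..<Suc n]. f j)"
        unfolding R_def x_def f_def by (intro foldr_append_cols_mult_vec(2)[OF _ r])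
      also have "\<dots> = sum f {0..<Suc n}" unfolding set_upt[symmetric] by (rule interv_sum_list_conv_sum_set_nat)
      also have "{0..<Suc n} = insert 0 (insert 1 {2..n})" using n by auto
      also have "sum f \<dots> = f 0 + (f 1 + sum f {2..n})" by simp
      \<comment> \<open>At most one of these blocks contributes, the one with \<open>j = i\<close>;
        for \<open>i = 1\<close> none does, and block 1 vanishes as well.\<close>
      also have "sum f {2..n} = (\<Sum>j=2..n. if j = i then weight 1 s * y i $ pindex k (opponents n i) s else 0)"
        by (rule sum.cong) (auto simp: f)
      also have "f 0 + (f 1 + \<dots>) = weight i s * y 0 $ ?r +
          (if i = 1 then 0 else weight 1 s * y i $ pindex k (opponents n i) s
             - weight i s * y 1 $ pindex k (opponents n 1) s)"
        using n i f[of 0] f[of 1] by auto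
      finally have "(D *\<^sub>v (R i *\<^sub>v x)) $ ?r = inverse (weight 1 s) * (weight i s * y 0 $ ?r +
          (if i = 1 then 0 else weight 1 s * y i $ pindex k (opponents n i) s
             - weight i s * y 1 $ pindex k (opponents n 1) s))"
        unfolding D_def mat_diag_mult_vec[OF z[OF i']] using r lambda_pindex[OF one s] by simp
      also have "\<dots> = payoff y i s"
        using weight_pos[OF one s] by (auto simp: payoff_def potential_def field_simps)
      finally show "(D *\<^sub>v (R i *\<^sub>v x)) $ ?r = structure_vec k {1..n} (payoff y i) $ ?r"
        unfolding structure_vec_index[OF finite_atLeastAtMost s] .
    qed
  qed
  finally show ?thesis unfolding x_def game_vec_eq_concat_vec .
qed

section \<open>The image consists of the coset weighted potential games\<close>

lemma payoff_fun_upd: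
  assumes "i \<in> {1..n}" "x \<in> {1..k i}" "t \<in> profiles k (opponents n i)"
  shows "payoff y i (t(i := x)) = w i t * potential y (t(i := x)) + y i $ pindex k (opponents n i) t"
proof -
  have "weight i (t(i := x)) = w i t"
    unfolding weight_def fun_upd_profiles(2)[OF assms(3,1,2)] ..
  moreover have "pindex k (opponents n i) (t(i := x)) = pindex k (opponents n i) t"
    by (rule profile_index_cong) simp
  ultimately show ?thesis unfolding payoff_def by simp
qed

text \<open>The summand taken from \<open>y i\<close> sees only the opponents, so it cancels when
  player \<open>i\<close> deviates, and the weighted difference of \<open>potential y\<close>
  remains.\<close>

lemma payoff_potential_game: "coset_weighted_potential_game n k w (payoff y)"
  unfolding coset_weighted_potential_game_def
  by (rule exI[of _ "potential y"]) (auto simp: payoff_fun_upd algebra_simps)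

lemma potential_game_is_payoff:
  assumes "coset_weighted_potential_game n k w c"
  obtains y where "\<And>j. j \<in> {0..n} \<Longrightarrow> y j \<in> carrier_vec (dims j)"
    and "game_vec n k c = game_vec n k (payoff y)"
proof -
  from assms obtain P where P: "\<And>i x x' t. i \<in> {1..n} \<Longrightarrow> x \<in> {1..k i} \<Longrightarrow> x' \<in> {1..k i} \<Longrightarrow>
      t \<in> profiles k (opponents n i) \<Longrightarrow>
      c i (t(i := x)) - c i (t(i := x')) = w i t * (P (t(i := x)) - P (t(i := x')))"
    unfolding coset_weighted_potential_game_def by blast
  \<comment> \<open>By the potential condition, \<open>c i\<close> minus the weighted
    \<open>P\<close> does not change with the own strategy of player \<open>i\<close>. It may be
    evaluated at any strategy, here at 1.\<close>
  define g where "g i t = c i (t(i := 1)) - w i t * P (t(i := 1))" for i t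
  \<comment> \<open>The first block must be w 1 * P + g 1, which is the payoff of player 1; with
    this choice \<open>potential y\<close> gives back \<open>P\<close> on profiles.\<close>
  define y where "y j = (if j = 0 then structure_vec k {1..n} (c 1)
    else structure_vec k (opponents n j) (g j))" for j
  have c: "c i s = weight i s * P s + g i (restrict s (opponents n i))" if i: "i \<in> {1..n}" and s: "s \<in> S" for i s
  proof -
    let ?t = "restrict s (opponents n i)"
    have t: "?t \<in> profiles k (opponents n i)" using s by (rule restrict_profiles) auto
    have "s \<in> extensional {1..n}" using s by (simp add: profiles_def PiE_iff)
    then have "?t(i := s i) = s" by (intro ext) (auto simp: extensional_def)
    moreover have "s i \<in> {1..k i}" "1 \<in> {1..k i}"
      using s i k[OF i] by (auto simp: profiles_def)
    ultimately show ?thesis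
      using P[OF i _ _ t, of "s i" 1] by (simp add: g_def weight_def algebra_simps)
  qed
  have y: "y j \<in> carrier_vec (dims j)" if "j \<in> {0..n}" for j
    using dims_player[of j] that by (auto simp: y_def dims_def structure_vec_carrier)
  have yi: "y i $ pindex k (opponents n i) s = g i (restrict s (opponents n i))" if i: "i \<in> {1..n}" and s: "s \<in> S" for i s
    using structure_vec_index[OF _ restrict_profiles[OF s, of "opponents n i"], of "g i"] i
    by (auto simp: y_def pindex_restrict)
  have one: "1 \<in> {1..n}" using n by simp
  have "potential y s = P s" if s: "s \<in> S" for s
    using structure_vec_index[OF finite_atLeastAtMost s, of "c 1"] c[OF one s] yi[OF one s] weight_pos[OF one s]
    by (simp add: potential_def y_def)
  then have "game_vec n k c = game_vec n k (payoff y)"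
    by (intro game_vec_cong) (simp only: payoff_def yi c)
  with y show ?thesis by (rule that)
qed

lemma cw_potential_games_eq_col_space:
  "cw_potential_games n k w = vec_space.col_space (n * K) (E_cw n k w)"
proof -
  let ?N = "\<Sum>j\<leftarrow>[0..<Suc n]. dims j"
  have mult: "E_cw n k w *\<^sub>v concat_vec (map y [0..<Suc n]) = game_vec n k (payoff y)"
    "concat_vec (map y [0..<Suc n]) \<in> carrier_vec ?N"
    if y: "\<And>j. j \<in> {0..n} \<Longrightarrow> y j \<in> carrier_vec (dims j)" for y
  proof -
    show "E_cw n k w *\<^sub>v concat_vec (map y [0..<Suc n]) = game_vec n k (payoff y)"
      by (rule E_cw_mult_vec[OF y])
    have "dim_vec (y j) = dims j" if "j \<in> set [0..<Suc n]" for j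
      using y[of j] that by auto
    then show "concat_vec (map y [0..<Suc n]) \<in> carrier_vec ?N"
      by (intro carrier_vecI) (simp only: dim_concat_vec map_map o_def cong: map_cong)
  qed
  have col: "v \<in> vec_space.col_space (n * K) (E_cw n k w) \<longleftrightarrow> (\<exists>x\<in>carrier_vec ?N. E_cw n k w *\<^sub>v x = v)" for v
    unfolding vec_space.col_space_eq[OF E_cw_carrier] carrier_matD[OF E_cw_carrier]
    using mult_mat_vec_carrier[OF E_cw_carrier] by blast
  show ?thesis
  proof (intro Set.set_eqI iffI)
    fix v assume "v \<in> cw_potential_games n k w"
    then obtain c where c: "v = game_vec n k c" "coset_weighted_potential_game n k w c"
      unfolding cw_potential_games_def by blast
    obtain y where y: "\<And>j. j \<in> {0..n} \<Longrightarrow> y j \<in> carrier_vec (dims j)"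
      and "game_vec n k c = game_vec n k (payoff y)"
      using potential_game_is_payoff[OF c(2)] by metis
    then show "v \<in> vec_space.col_space (n * K) (E_cw n k w)"
      unfolding col c(1) using mult[OF y] by metis
  next
    fix v assume "v \<in> vec_space.col_space (n * K) (E_cw n k w)"
    then obtain x where x: "x \<in> carrier_vec ?N" "E_cw n k w *\<^sub>v x = v" unfolding col by blast
    obtain y where y: "\<And>j. j \<in> set [0..<Suc n] \<Longrightarrow> y j \<in> carrier_vec (dims j)"
      "x = concat_vec (map y [0..<Suc n])"
      by (rule concat_vec_split[OF x(1)]) auto
    have "v = game_vec n k (payoff y)"
      unfolding x(2)[symmetric] y(2) by (rule E_cw_mult_vec) (rule y(1), auto)
    then show "v \<in> cw_potential_games n k w"
      unfolding cw_potential_games_def using payoff_potential_game by blast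
  qed
qed

text \<open>For each i the potential equals - g i / w i, which is blind to the strategy of player i;
  hence it is constant and one zero suffices. The hypothesis \<open>last\<close> provides that zero.
  Then every g i vanishes, and with g 1 and the potential also a.\<close>

lemma E_cw_kernel:
  assumes y: "\<And>j. j \<in> {0..n} \<Longrightarrow> y j \<in> carrier_vec (dims j)"
    and zero: "\<And>i s. i \<in> {1..n} \<Longrightarrow> s \<in> S \<Longrightarrow> payoff y i s = 0"
    and last: "y n $ (dims n - 1) = 0"
    and j: "j \<in> {0..n}"
  shows "y j = 0\<^sub>v (dims j)"
proof -
  have one: "1 \<in> {1..n}" and nn: "n \<in> {1..n}" using n by simp_all
  have pot: "potential y s = - (y i $ pindex k (opponents n i) s) / weight i s" if "i \<in> {1..n}" "s \<in> S" for i s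
    using zero[OF that] weight_pos[OF that] by (simp add: payoff_def field_simps)
  have step: "potential y (s(i := x)) = potential y s"
    if i: "i \<in> {1..n}" and s: "s \<in> S" and x: "x \<in> {1..k i}" for i s x
  proof -
    have s': "s(i := x) \<in> S"
      using s x i unfolding profiles_def by (auto simp: PiE_iff extensional_def)
    have "weight i (s(i := x)) = weight i s"
      unfolding weight_def by (rule arg_cong[of _ _ "w i"]) auto
    moreover have "pindex k (opponents n i) (s(i := x)) = pindex k (opponents n i) s"
      by (rule profile_index_cong) simp
    ultimately show ?thesis unfolding pot[OF i s] pot[OF i s'] by simp
  qed
  have lt: "dims n - 1 < (\<Prod>j\<in>opponents n n. k j)"
    unfolding dims_player[OF nn] using k by (intro diff_less prod_pos) force+
  \<comment> \<open>The opponents' profile of player \<open>n\<close> whose number is the last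
    index. Completed by any strategy of player \<open>n\<close>, it is a zero of the
    potential.\<close>
  obtain t where t: "t \<in> profiles k (opponents n n)" "pindex k (opponents n n) t = dims n - 1"
    by (rule pindex_surj[OF finite_Diff[OF finite_atLeastAtMost] lt])
  have x: "1 \<in> {1..k i}" if "i \<in> {1..n}" for i using k[OF that] by auto
  have s0: "t(n := 1) \<in> S" using fun_upd_profiles(1)[OF t(1) nn x[OF nn]] .
  have "payoff y n (t(n := 1)) = w n t * potential y (t(n := 1))"
    unfolding payoff_fun_upd[OF nn x[OF nn] t(1)] t(2) last by simp
  then have "potential y (t(n := 1)) = 0"
    using zero[OF nn s0] w[OF nn t(1)] by simp
  then have pot0: "potential y s = 0" if "s \<in> S" for s
    using profiles_induct_coordinates[OF that s0, of "potential y"] step by metis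
  show ?thesis
  proof (cases "j = 0")
    case True
    show ?thesis unfolding True
    proof (rule vec_eq_on_profiles[OF finite_atLeastAtMost])
      show "y 0 \<in> carrier_vec K" using y[of 0] by (simp add: dims_def)
      show "0\<^sub>v (dims 0) \<in> carrier_vec K" by (simp add: dims_def)
      fix s assume s: "s \<in> S"
      have "y 1 $ pindex k (opponents n 1) s = 0"
        using zero[OF one s] pot0[OF s] by (simp add: payoff_def)
      then have "y 0 $ pindex k {1..n} s = 0"
        using pot0[OF s] weight_pos[OF one s] by (simp add: potential_def)
      moreover have "pindex k {1..n} s < dims 0"
        unfolding dims_def using s by (simp only: pindex_less finite_atLeastAtMost simp_thms if_True)
      ultimately show "y 0 $ pindex k {1..n} s = 0\<^sub>v (dims 0) $ pindex k {1..n} s" by simp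
    qed
  next
    case False
    then have j': "j \<in> {1..n}" using j by auto
    have fin: "finite (opponents n j)" by simp
    show ?thesis unfolding dims_player[OF j']
    proof (rule vec_eq_on_profiles[OF fin])
      show "y j \<in> carrier_vec (\<Prod>i\<in>opponents n j. k i)" using y[OF j] unfolding dims_player[OF j'] .
      fix t assume t: "t \<in> profiles k (opponents n j)"
      have s: "t(j := 1) \<in> S" using fun_upd_profiles(1)[OF t j' x[OF j']] .
      have "y j $ pindex k (opponents n j) t = 0"
        using zero[OF j' s] pot0[OF s] unfolding payoff_fun_upd[OF j' x[OF j'] t] by simp
      then show "y j $ pindex k (opponents n j) t =
          0\<^sub>v (\<Prod>i\<in>opponents n j. k i) $ pindex k (opponents n j) t"
        using pindex_less[OF fin t] by simp
    qed simp
  qed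
qed

lemma cols_basis_of_E_cw0:
  "cols_basis_of (n * K) (E_cw0 n k w) (vec_space.col_space (n * K) (E_cw n k w))"
proof -
  let ?N = "\<Sum>j\<leftarrow>[0..<Suc n]. dims j"
  have nn: "n \<in> {1..n}" using n by simp
  have dn: "dims n > 0"
    unfolding dims_player[OF nn] using k by (intro prod_pos) force
  have "?N = (\<Sum>j\<leftarrow>[0..<n]. dims j) + dims n" by simp
  then obtain p where p: "?N = Suc p" using dn by (metis gr0_implies_Suc add_gr_0)
  \<comment> \<open>Indices start at 0 and the domain has dimension \<open>Suc p\<close>, so
    \<open>p\<close> is the index of the deleted column; it falls on the last entry of block
    \<open>n\<close>.\<close>
  have split: "concat_vec (map y [0..<Suc n]) $ p = y n $ (dims n - 1)"
    if y: "\<And>j. j \<in> {0..n} \<Longrightarrow> y j \<in> carrier_vec (dims j)" for y :: "nat \<Rightarrow> real vec"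
  proof -
    have yd: "dim_vec (y j) = dims j" if "j \<in> set [0..<Suc n]" for j
      using y[of j] that by auto
    have "dim_vec (concat_vec (map y [0..<Suc n])) = Suc p"
      unfolding p[symmetric] by (simp only: yd dim_concat_vec map_map o_def cong: map_cong)
    moreover have "map y [0..<Suc n] = map y [0..<n] @ [y n]" by simp
    ultimately show ?thesis
      using concat_vec_last[of "y n" "map y [0..<n]"] dn yd[of n] by (simp del: upt_Suc)
  qed
  \<comment> \<open>The direction of a constant shift of the potential: with a = 0 and g i = w i the
    potential is constantly -1, and each payoff is w i * (-1) + w i = 0.\<close>
  define v where "v j = (if j = 0 then 0\<^sub>v K else structure_vec k (opponents n j) (w j))" for j
  have v: "v j \<in> carrier_vec (dims j)" if "j \<in> {0..n}" for j
    using dims_player[of j] that by (auto simp: v_def dims_def structure_vec_carrier)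
  have vi: "v i $ pindex k (opponents n i) s = weight i s" if "i \<in> {1..n}" "s \<in> S" for i s
    using structure_vec_index[OF _ restrict_profiles[OF that(2), of "opponents n i"], of "w i"] that(1)
    by (auto simp: v_def pindex_restrict weight_def)
  have pot: "potential v s = - 1" if s: "s \<in> S" for s
  proof -
    have one: "1 \<in> {1..n}" using n by simp
    have "pindex k {1..n} s < K" using s by (simp only: pindex_less finite_atLeastAtMost)
    then have "v 0 $ pindex k {1..n} s = 0" by (simp add: v_def)
    then show ?thesis
      using vi[OF one s] weight_pos[OF one s] by (simp add: potential_def)
  qed
  have lt: "dims n - 1 < (\<Prod>j\<in>opponents n n. k j)"
    using dn unfolding dims_player[OF nn] by simp
  obtain t where t: "t \<in> profiles k (opponents n n)" "pindex k (opponents n n) t = dims n - 1"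
    by (rule pindex_surj[OF finite_Diff[OF finite_atLeastAtMost] lt])
  show ?thesis
    unfolding E_cw0_def
  proof (rule cols_basis_of_delete_last_col[OF E_cw_carrier[unfolded p]])
    fix x assume x: "x \<in> carrier_vec (Suc p)" "E_cw n k w *\<^sub>v x = 0\<^sub>v (n * K)" "x $ p = 0"
    obtain y where y': "\<And>j. j \<in> set [0..<Suc n] \<Longrightarrow> y j \<in> carrier_vec (dims j)"
      "x = concat_vec (map y [0..<Suc n])"
      by (rule concat_vec_split[OF x(1)[folded p]]) auto
    have y: "y j \<in> carrier_vec (dims j)" if "j \<in> {0..n}" for j using that by (intro y'(1)) auto
    have "game_vec n k (payoff y) = E_cw n k w *\<^sub>v x"
      unfolding y'(2) by (rule E_cw_mult_vec[OF y, symmetric])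
    also have "\<dots> = 0\<^sub>v (n * K)" by (rule x(2))
    finally have "payoff y i s = 0" if "i \<in> {1..n}" "s \<in> S" for i s
      unfolding game_vec_eq_zero_iff using that by blast
    moreover have "y n $ (dims n - 1) = x $ p" unfolding y'(2) by (rule split[OF y, symmetric])
    then have "y n $ (dims n - 1) = 0" unfolding x(3) .
    ultimately have "y j = 0\<^sub>v (dims j)" if "j \<in> {0..n}" for j
      using E_cw_kernel[OF y] that by blast
    then have "map y [0..<Suc n] = map (\<lambda>j. 0\<^sub>v (dims j)) [0..<Suc n]"
      by (intro map_cong refl) auto
    then show "x = 0\<^sub>v (Suc p)" unfolding y'(2) p[symmetric] concat_vec_zero[symmetric] by (rule arg_cong)
  next
    show "concat_vec (map v [0..<Suc n]) \<in> carrier_vec (Suc p)"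
    proof (rule carrier_vecI)
      have "dim_vec (v j) = dims j" if "j \<in> set [0..<Suc n]" for j
        using v[of j] that by auto
      then show "dim_vec (concat_vec (map v [0..<Suc n])) = Suc p"
        unfolding p[symmetric] by (simp only: dim_concat_vec map_map o_def cong: map_cong)
    qed
    have "E_cw n k w *\<^sub>v concat_vec (map v [0..<Suc n]) = game_vec n k (payoff v)"
      by (rule E_cw_mult_vec[OF v])
    also have "\<dots> = 0\<^sub>v (n * K)"
      unfolding game_vec_eq_zero_iff
    proof (intro ballI)
      fix i s assume i: "i \<in> {1..n}" and s: "s \<in> S"
      show "payoff v i s = 0" unfolding payoff_def vi[OF i s] pot[OF s] by simp
    qed
    finally show "E_cw n k w *\<^sub>v concat_vec (map v [0..<Suc n]) = 0\<^sub>v (n * K)" .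
    \<comment> \<open>The last entry of \<open>v\<close> is a single value of the weight of player
      \<open>n\<close>, hence positive.\<close>
    have "concat_vec (map v [0..<Suc n]) $ p = v n $ (dims n - 1)" by (rule split[OF v])
    also have "\<dots> = w n t"
      unfolding t(2)[symmetric] using n structure_vec_index[OF finite_Diff[OF finite_atLeastAtMost] t(1)]
      by (simp add: v_def)
    finally have "concat_vec (map v [0..<Suc n]) $ p = w n t" .
    then show "concat_vec (map v [0..<Suc n]) $ p \<noteq> 0"
      using w[OF nn t(1)] by simp
  qed
qed

end

theorem theorem13:
  fixes n :: nat
    and k :: "nat \<Rightarrow> nat"
    and w :: "nat \<Rightarrow> (nat \<Rightarrow> nat) \<Rightarrow> real"
  assumes "n \<ge> 2"
    and "\<And>i. i \<in> {1..n} \<Longrightarrow> k i \<ge> 2"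
    and "\<And>i t. i \<in> {1..n} \<Longrightarrow> t \<in> profiles k (opponents n i) \<Longrightarrow> w i t > 0"
  shows "cw_potential_games n k w = vec_space.col_space (n * (\<Prod>j\<in>{1..n}. k j)) (E_cw n k w)
    \<and> cols_basis_of (n * (\<Prod>j\<in>{1..n}. k j)) (E_cw0 n k w) (cw_potential_games n k w)"
  using cw_potential_games_eq_col_space[OF assms] cols_basis_of_E_cw0[OF assms] by simp

end
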